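(* Let $k$ be a field, $R=k[x_1,\dots,x_n]$, and let $I$ be a monomial ideal of $R$ with $\dim_k(R/I)<\infty$. Let $M=R/I$, regarded as an $R$-module. Then: 1. $\langle E_M(0)\rangle=\mathcal{S}(M)=\beta(M)=\mathcal{J}(M)$; 2. $M$ satisfies the radical formula.
   Context: An $R$-module $N$ is prime if for all $a\in R$, $m\in N$, $am=0$ implies $m=0$ or $aN=0$; it is reduced if for all $a\in R$, $m\in N$, $a^2m=0$ implies $am=0$. A submodule $P$ of $M$ is prime (resp. semiprime) if $M/P$ is a prime (resp. reduced) $R$-module. $\beta(M)$ (resp. $\mathcal{S}(M)$) is the intersection of all prime (resp. semiprime) submodules of $M$, and $\mathcal{J}(M)$ is the intersection of all maximal submodules of $M$. For a submodule $N$ of $M$, let $\beta_M(N)$ be the intersection of all prime submodules of $M$ containing $N$ (so $\beta_M(0)=\beta(M)$). An intersection over an empty family of submodules of $M$ is $M$. The envelope of $N$ is the set $E_M(N)=\{rm : r\in R,\ m\in M,\ r^tm\in N\text{ for some }t\in\mathbb{Z}^+\}$, and $\langle E_M(N)\rangle$ is the submodule of $M$ it generates. $N$ satisfies the radical formula if $\langle E_M(N)\rangle=\beta_M(N)$; the module $M$ satisfies the radical formula if every submodule $N$ of $M$ does. *)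

theory Defs
  imports "HOL-Library.Poly_Mapping" "HOL-Algebra.Algebra"
begin

section \<open>Polynomial rings and monomial ideals\<close>

type_synonym 'k mpol = "(nat \<Rightarrow>\<^sub>0 nat) \<Rightarrow>\<^sub>0 'k"

text \<open>
  An exponent vector is a finitely supported map from variable indices to exponents, and the
  multiplication of \<open>'k mpol\<close> is the convolution product. Polynomials in
  \<open>x\<^sub>1, \<dots>, x\<^sub>n\<close> are those in which only variables with index in \<open>{1..n}\<close> occur.
\<close>

definition exponents :: "nat \<Rightarrow> (nat \<Rightarrow>\<^sub>0 nat) set" where
  "exponents n = {e. Poly_Mapping.keys e \<subseteq> {1..n}}"

definition mpoly_ring :: "nat \<Rightarrow> 'k::field mpol ring" where
  "mpoly_ring n =
    \<lparr>carrier = {p. Poly_Mapping.keys p \<subseteq> exponents n},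
     monoid.mult = (*), one = 1, ring.zero = 0, add = (+)\<rparr>"

definition const_poly :: "'k::field \<Rightarrow> 'k mpol" where
  "const_poly c = Poly_Mapping.single 0 c"

definition monomials :: "nat \<Rightarrow> 'k::field mpol set" where
  "monomials n = {Poly_Mapping.single e 1 | e. e \<in> exponents n}"

definition monomial_ideal :: "nat \<Rightarrow> 'k::field mpol set \<Rightarrow> bool" where
  "monomial_ideal n I \<longleftrightarrow> (\<exists>S \<subseteq> monomials n. I = Idl\<^bsub>mpoly_ring n\<^esub> S)"

text \<open>
  The scalar action of \<open>c \<in> k\<close> on \<open>R/I\<close> is multiplication by the coset of the constant
  polynomial \<open>c\<close>, so \<open>k\<close> enters the library's notion of dimension through its image in \<open>R/I\<close>.
  If \<open>I = R\<close>, that image is \<open>{0}\<close> and \<open>R/I\<close> has dimension \<open>0\<close>, as it should.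
\<close>

definition finite_dim_quotient :: "nat \<Rightarrow> 'k::field mpol set \<Rightarrow> bool" where
  "finite_dim_quotient n I \<longleftrightarrow>
    ring.finite_dimension (mpoly_ring n Quot I)
      (range (\<lambda>c. I +>\<^bsub>mpoly_ring n\<^esub> const_poly c))
      (carrier (mpoly_ring n Quot I))"


section \<open>Quotient modules\<close>

definition regular_module :: "'a ring \<Rightarrow> ('a, 'a) module" where
  "regular_module R = ring.extend R (module.fields ((\<otimes>\<^bsub>R\<^esub>)))"

text \<open>
  The fields \<open>mult\<close> and \<open>one\<close> that a module record inherits from the ring record play no role
  in the theory of modules. For a coset \<open>A\<close> of \<open>N\<close>, all the cosets in the union below coincide.
\<close>

definition quotient_module ::
    "('a, 'b) module \<Rightarrow> 'b set \<Rightarrow> ('a, 'b set) module" where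
  "quotient_module M N =
    ring.extend (M Quot N) (module.fields (\<lambda>a A. \<Union>x\<in>A. N +>\<^bsub>M\<^esub> (a \<odot>\<^bsub>M\<^esub> x)))"


section \<open>Prime, semiprime and maximal submodules; radicals\<close>

text \<open>
  The zero module is prime and reduced, so \<open>M\<close> is a prime and a semiprime submodule of itself.
  This does not affect intersections, since an intersection of submodules of \<open>M\<close> is taken
  inside \<open>M\<close>, the empty one being \<open>M\<close>.
\<close>

definition prime_module :: "'a ring \<Rightarrow> ('a, 'b) module \<Rightarrow> bool" where
  "prime_module R N \<longleftrightarrow>
    (\<forall>a \<in> carrier R. \<forall>m \<in> carrier N. a \<odot>\<^bsub>N\<^esub> m = \<zero>\<^bsub>N\<^esub> \<longrightarrow>
      m = \<zero>\<^bsub>N\<^esub> \<or> (\<forall>x \<in> carrier N. a \<odot>\<^bsub>N\<^esub> x = \<zero>\<^bsub>N\<^esub>))"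

definition reduced_module :: "'a ring \<Rightarrow> ('a, 'b) module \<Rightarrow> bool" where
  "reduced_module R N \<longleftrightarrow>
    (\<forall>a \<in> carrier R. \<forall>m \<in> carrier N.
      (a [^]\<^bsub>R\<^esub> (2::nat)) \<odot>\<^bsub>N\<^esub> m = \<zero>\<^bsub>N\<^esub> \<longrightarrow> a \<odot>\<^bsub>N\<^esub> m = \<zero>\<^bsub>N\<^esub>)"

definition prime_submodule :: "'a ring \<Rightarrow> ('a, 'b) module \<Rightarrow> 'b set \<Rightarrow> bool" where
  "prime_submodule R M P \<longleftrightarrow> submodule P R M \<and> prime_module R (quotient_module M P)"

definition semiprime_submodule :: "'a ring \<Rightarrow> ('a, 'b) module \<Rightarrow> 'b set \<Rightarrow> bool" where
  "semiprime_submodule R M P \<longleftrightarrow> submodule P R M \<and> reduced_module R (quotient_module M P)"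

definition maximal_submodule :: "'a ring \<Rightarrow> ('a, 'b) module \<Rightarrow> 'b set \<Rightarrow> bool" where
  "maximal_submodule R M P \<longleftrightarrow> submodule P R M \<and> P \<noteq> carrier M \<and>
    (\<forall>N. submodule N R M \<and> P \<subseteq> N \<longrightarrow> N = P \<or> N = carrier M)"

definition Inter_in :: "('a, 'b) module \<Rightarrow> 'b set set \<Rightarrow> 'b set" where
  "Inter_in M F = carrier M \<inter> \<Inter>F"

definition prime_radical :: "'a ring \<Rightarrow> ('a, 'b) module \<Rightarrow> 'b set" where
  "prime_radical R M = Inter_in M {P. prime_submodule R M P}"

definition semiprime_radical :: "'a ring \<Rightarrow> ('a, 'b) module \<Rightarrow> 'b set" where
  "semiprime_radical R M = Inter_in M {P. semiprime_submodule R M P}"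

definition jacobson_radical :: "'a ring \<Rightarrow> ('a, 'b) module \<Rightarrow> 'b set" where
  "jacobson_radical R M = Inter_in M {P. maximal_submodule R M P}"

definition prime_radical_of :: "'a ring \<Rightarrow> ('a, 'b) module \<Rightarrow> 'b set \<Rightarrow> 'b set" where
  "prime_radical_of R M N = Inter_in M {P. prime_submodule R M P \<and> N \<subseteq> P}"


section \<open>Envelopes and the radical formula\<close>

definition envelope :: "'a ring \<Rightarrow> ('a, 'b) module \<Rightarrow> 'b set \<Rightarrow> 'b set" where
  "envelope R M N =
    {r \<odot>\<^bsub>M\<^esub> m | r m. r \<in> carrier R \<and> m \<in> carrier M \<and>
      (\<exists>t::nat. t > 0 \<and> (r [^]\<^bsub>R\<^esub> t) \<odot>\<^bsub>M\<^esub> m \<in> N)}"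

definition submodule_generated :: "'a ring \<Rightarrow> ('a, 'b) module \<Rightarrow> 'b set \<Rightarrow> 'b set" where
  "submodule_generated R M S = Inter_in M {N. submodule N R M \<and> S \<subseteq> N}"

definition submodule_radical_formula :: "'a ring \<Rightarrow> ('a, 'b) module \<Rightarrow> 'b set \<Rightarrow> bool" where
  "submodule_radical_formula R M N \<longleftrightarrow>
    submodule_generated R M (envelope R M N) = prime_radical_of R M N"

definition radical_formula :: "'a ring \<Rightarrow> ('a, 'b) module \<Rightarrow> bool" where
  "radical_formula R M \<longleftrightarrow> (\<forall>N. submodule N R M \<longrightarrow> submodule_radical_formula R M N)"

end

theory Submission
  imports Defs
begin

text \<open>
  For a submodule \<open>N\<close> of \<open>M = R/I\<close> one has
  \<open>\<langle>E\<^sub>M(N)\<rangle> \<subseteq> \<S>\<^sub>M(N) \<subseteq> \<beta>\<^sub>M(N) \<subseteq> \<J>\<^sub>M(N)\<close>, the intersections of the semiprime, prime and maximal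
  submodules containing \<open>N\<close>, because maximal submodules are prime and prime ones are semiprime.
  It remains to see that \<open>\<J>\<^sub>M(N)\<close> lies in \<open>E\<^sub>M(N)\<close>. As \<open>R/I\<close> is finite-dimensional, the powers of
  the class of \<open>a \<in> R\<close> are linearly dependent, so \<open>a\<^sup>j(1 - ab) \<in> I\<close> for some \<open>j\<close> and \<open>b\<close>. If the
  class of \<open>a\<close> is in \<open>\<J>\<^sub>M(N)\<close>, then \<open>1 - ab\<close> is a unit modulo \<open>N\<close>, and so the class of \<open>a\<^sup>j\<close> is
  in \<open>N\<close>.
\<close>

section \<open>Quotient modules\<close>

text \<open>The radicals and envelopes are defined for unextended ring and module records only.\<close>

locale plain_module = module R M
  for R :: "'a ring" (structure) and M :: "('a, 'b) module" (structure)

lemma quotient_module_simps [simp]: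
  "carrier (quotient_module M N) = a_rcosets\<^bsub>M\<^esub> N"
  "\<zero>\<^bsub>quotient_module M N\<^esub> = N"
  "add (quotient_module M N) = set_add M"
  "smult (quotient_module M N) = (\<lambda>a A. \<Union>x\<in>A. N +>\<^bsub>M\<^esub> (a \<odot>\<^bsub>M\<^esub> x))"
  by (simp_all add: quotient_module_def FactRing_def ring.defs module.defs)

lemma (in module) submodule_abelian_subgroup:
  assumes "submodule N R M"
  shows "abelian_subgroup N M"
  using abelian_subgroupI2[OF M.a_comm_group submodule.axioms(1)[OF assms]] .

lemma (in module) submodule_zero:
  assumes "submodule N R M"
  shows "\<zero>\<^bsub>M\<^esub> \<in> N"
  using subgroup.one_closed[OF submodule.axioms(1)[OF assms]] by simp

lemma (in module) submodule_coset_eq_iff: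
  assumes "submodule N R M" "x \<in> carrier M" "y \<in> carrier M"
  shows "N +>\<^bsub>M\<^esub> x = N +>\<^bsub>M\<^esub> y \<longleftrightarrow> x \<ominus>\<^bsub>M\<^esub> y \<in> N"
proof -
  interpret N: abelian_subgroup N M by (rule submodule_abelian_subgroup[OF assms(1)])
  have "x \<in> N +>\<^bsub>M\<^esub> y \<longleftrightarrow> x \<ominus>\<^bsub>M\<^esub> y \<in> N"
    using N.a_rcos_module[OF assms(3,2)] by (simp add: a_minus_def)
  moreover have "x \<in> N +>\<^bsub>M\<^esub> y \<longleftrightarrow> N +>\<^bsub>M\<^esub> x = N +>\<^bsub>M\<^esub> y"
  proof
    assume "x \<in> N +>\<^bsub>M\<^esub> y"
    then show "N +>\<^bsub>M\<^esub> x = N +>\<^bsub>M\<^esub> y"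
      using M.a_repr_independence[OF _ assms(3) N.a_subgroup] by simp
  next
    assume "N +>\<^bsub>M\<^esub> x = N +>\<^bsub>M\<^esub> y"
    then show "x \<in> N +>\<^bsub>M\<^esub> y" using N.a_rcos_self[OF assms(2)] by simp
  qed
  ultimately show ?thesis by simp
qed

lemma (in module) submodule_coset_eq_self_iff:
  assumes "submodule N R M" "x \<in> carrier M"
  shows "N +>\<^bsub>M\<^esub> x = N \<longleftrightarrow> x \<in> N"
  using M.a_coset_join1 M.a_coset_join2 submodule.axioms(1) assms by metis

context plain_module
begin

text \<open>If \<open>y\<close> and \<open>x\<close> lie in the same coset of \<open>N\<close>, then
  a(y - x) is in \<open>N\<close>, so all cosets in the union defining the action agree. The union
  is over a nonempty coset and therefore equals this common value.\<close>

lemma quotient_smult_coset: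
  assumes N: "submodule N R M" and a: "a \<in> carrier R" and x: "x \<in> carrier M"
  shows "a \<odot>\<^bsub>quotient_module M N\<^esub> (N +>\<^bsub>M\<^esub> x) = N +>\<^bsub>M\<^esub> (a \<odot>\<^bsub>M\<^esub> x)"
proof -
  interpret N: abelian_subgroup N M by (rule submodule_abelian_subgroup[OF N])
  have "N +>\<^bsub>M\<^esub> (a \<odot>\<^bsub>M\<^esub> y) = N +>\<^bsub>M\<^esub> (a \<odot>\<^bsub>M\<^esub> x)" if "y \<in> N +>\<^bsub>M\<^esub> x" for y
  proof -
    have y: "y \<in> carrier M"
      using that M.a_r_coset_subset_G[OF submoduleE(1)[OF N] x] by blast
    have "N +>\<^bsub>M\<^esub> y = N +>\<^bsub>M\<^esub> x"
      using M.a_repr_independence[OF that x N.a_subgroup] by simp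
    then have "a \<odot>\<^bsub>M\<^esub> (y \<ominus>\<^bsub>M\<^esub> x) \<in> N"
      using submodule_coset_eq_iff[OF N y x] submoduleE(4)[OF N a] by simp
    then have "a \<odot>\<^bsub>M\<^esub> y \<ominus>\<^bsub>M\<^esub> a \<odot>\<^bsub>M\<^esub> x \<in> N"
      using a x y by (simp add: a_minus_def smult_r_distr smult_r_minus)
    then show ?thesis using submodule_coset_eq_iff[OF N] a x y by simp
  qed
  then have "(\<Union>y\<in>N +>\<^bsub>M\<^esub> x. N +>\<^bsub>M\<^esub> (a \<odot>\<^bsub>M\<^esub> y)) = (\<Union>y\<in>N +>\<^bsub>M\<^esub> x. N +>\<^bsub>M\<^esub> (a \<odot>\<^bsub>M\<^esub> x))"
    by (intro SUP_cong refl)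
  moreover have "N +>\<^bsub>M\<^esub> x \<noteq> {}" using N.a_rcos_self[OF x] by blast
  ultimately show ?thesis by simp
qed

text \<open>Every element is a coset of some representative, and sum and action are computed on
  representatives, so the axioms descend from \<open>M\<close>.\<close>

lemma quotient_plain_module:
  assumes N: "submodule N R M"
  shows "plain_module R (quotient_module M N)"
proof -
  interpret N: abelian_subgroup N M by (rule submodule_abelian_subgroup[OF N])
  note [simp del] = quotient_module_simps(4)
  have cos: "\<exists>x\<in>carrier M. A = N +>\<^bsub>M\<^esub> x" if "A \<in> a_rcosets\<^bsub>M\<^esub> N" for A
    using that by (auto simp: A_RCOSETS_def')
  have mem: "x \<in> carrier M \<Longrightarrow> N +>\<^bsub>M\<^esub> x \<in> a_rcosets\<^bsub>M\<^esub> N" for x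
    by (rule M.a_rcosetsI[OF submoduleE(1)[OF N]])
  have "abelian_group (quotient_module M N)"
  proof (rule abelian_groupI)
    fix A assume "A \<in> carrier (quotient_module M N)"
    then have "A \<in> a_rcosets\<^bsub>M\<^esub> N" by simp
    then show "\<exists>B\<in>carrier (quotient_module M N). B \<oplus>\<^bsub>quotient_module M N\<^esub> A = \<zero>\<^bsub>quotient_module M N\<^esub>"
      using N.a_setinv_closed N.a_rcosets_inv_mult_group_eq by auto
  next
    fix A B assume "A \<in> carrier (quotient_module M N)" "B \<in> carrier (quotient_module M N)"
    then obtain x y where "x \<in> carrier M" "y \<in> carrier M" "A = N +>\<^bsub>M\<^esub> x" "B = N +>\<^bsub>M\<^esub> y"
      using cos by auto metis
    then show "A \<oplus>\<^bsub>quotient_module M N\<^esub> B = B \<oplus>\<^bsub>quotient_module M N\<^esub> A"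
      by (simp add: N.a_rcos_sum M.a_comm)
  qed (simp_all add: N.a_setmult_closed N.a_subgroup_in_rcosets N.a_rcosets_assoc N.rcosets_add_eq)
  moreover have "\<And>a A. a \<in> carrier R \<Longrightarrow> A \<in> carrier (quotient_module M N) \<Longrightarrow>
      a \<odot>\<^bsub>quotient_module M N\<^esub> A \<in> carrier (quotient_module M N)"
    using cos mem quotient_smult_coset[OF N] by fastforce
  ultimately have "module R (quotient_module M N)"
    by (intro moduleI R.is_cring)
      (auto dest!: cos simp: quotient_smult_coset[OF N] N.a_rcos_sum smult_l_distr smult_r_distr
        smult_assoc1)
  then show ?thesis by (simp add: plain_module_def)
qed

section \<open>Semiprime, prime and maximal submodules\<close>

text \<open>A coset is zero in M/P exactly if its representative lies in \<open>P\<close>, which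
  pulls the condition back to \<open>M\<close>. The square becomes two successive actions, the form
  in which exponents are lowered in \<open>envelope_subset_semiprime\<close>.\<close>

lemma semiprime_submodule_iff:
  "semiprime_submodule R M P \<longleftrightarrow> submodule P R M \<and>
    (\<forall>a\<in>carrier R. \<forall>x\<in>carrier M. a \<odot>\<^bsub>M\<^esub> (a \<odot>\<^bsub>M\<^esub> x) \<in> P \<longrightarrow> a \<odot>\<^bsub>M\<^esub> x \<in> P)"
proof (cases "submodule P R M")
  case True
  show ?thesis
    unfolding semiprime_submodule_def reduced_module_def
    using True
    by (simp add: A_RCOSETS_def' quotient_smult_coset submodule_coset_eq_self_iff numeral_2_eq_2
        smult_assoc1 del: quotient_module_simps(4))
qed (simp add: semiprime_submodule_def)

lemma prime_submodule_iff:
  "prime_submodule R M P \<longleftrightarrow> submodule P R M \<and>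
    (\<forall>a\<in>carrier R. \<forall>x\<in>carrier M. a \<odot>\<^bsub>M\<^esub> x \<in> P \<longrightarrow>
      x \<in> P \<or> (\<forall>y\<in>carrier M. a \<odot>\<^bsub>M\<^esub> y \<in> P))"
proof (cases "submodule P R M")
  case True
  show ?thesis
    unfolding prime_submodule_def prime_module_def
    using True
    by (simp add: A_RCOSETS_def' quotient_smult_coset submodule_coset_eq_self_iff
        del: quotient_module_simps(4))
qed (simp add: prime_submodule_def)

text \<open>Primeness for \<open>a\<close> and the element ax gives ax in \<open>P\<close> or aM
  inside \<open>P\<close>; the second case contains the first.\<close>

lemma prime_imp_semiprime:
  assumes "prime_submodule R M P"
  shows "semiprime_submodule R M P"
  using assms unfolding prime_submodule_iff semiprime_submodule_iff
  by (meson smult_closed)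

text \<open>This is N + Rw in explicit form, so that an element of it can be decomposed: an
  arbitrary one if \<open>N\<close> is maximal and \<open>w\<close> lies outside, and later the
  generator of a cyclic module.\<close>

lemma submodule_sum_cyclic:
  assumes N: "submodule N R M" and w: "w \<in> carrier M"
  shows "submodule {y \<oplus>\<^bsub>M\<^esub> s \<odot>\<^bsub>M\<^esub> w | y s. y \<in> N \<and> s \<in> carrier R} R M"
    (is "submodule ?S R M")
    and "N \<subseteq> {y \<oplus>\<^bsub>M\<^esub> s \<odot>\<^bsub>M\<^esub> w | y s. y \<in> N \<and> s \<in> carrier R}"
    and "w \<in> {y \<oplus>\<^bsub>M\<^esub> s \<odot>\<^bsub>M\<^esub> w | y s. y \<in> N \<and> s \<in> carrier R}"
proof -
  have NM: "y \<in> carrier M" if "y \<in> N" for y using submoduleE(1)[OF N] that by blast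
  have N0: "\<zero>\<^bsub>M\<^esub> \<in> N" by (rule submodule_zero[OF N])
  show sub: "N \<subseteq> ?S"
  proof
    fix y assume "y \<in> N"
    then show "y \<in> ?S" using w NM by (intro CollectI exI[of _ y] exI[of _ \<zero>]) simp
  qed
  show "w \<in> ?S"
    using w N0 by (intro CollectI exI[of _ "\<zero>\<^bsub>M\<^esub>"] exI[of _ \<one>]) simp
  show "submodule ?S R M"
  proof (rule submoduleI)
    show "?S \<subseteq> carrier M" using NM w by auto
    show "\<zero>\<^bsub>M\<^esub> \<in> ?S" using sub N0 by blast
    fix u assume "u \<in> ?S"
    then obtain y s where u: "u = y \<oplus>\<^bsub>M\<^esub> s \<odot>\<^bsub>M\<^esub> w" "y \<in> N" "s \<in> carrier R" by blast
    then have "\<ominus>\<^bsub>M\<^esub> u = (\<ominus>\<^bsub>M\<^esub> y) \<oplus>\<^bsub>M\<^esub> (\<ominus> s) \<odot>\<^bsub>M\<^esub> w"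
      using NM w by (simp add: M.minus_add smult_l_minus)
    then show "\<ominus>\<^bsub>M\<^esub> u \<in> ?S" using u submoduleE(3)[OF N] by blast
    {
      fix v assume "v \<in> ?S"
      then obtain z t where v: "v = z \<oplus>\<^bsub>M\<^esub> t \<odot>\<^bsub>M\<^esub> w" "z \<in> N" "t \<in> carrier R" by blast
      have "u \<oplus>\<^bsub>M\<^esub> v = (y \<oplus>\<^bsub>M\<^esub> z) \<oplus>\<^bsub>M\<^esub> (s \<oplus> t) \<odot>\<^bsub>M\<^esub> w"
        using u v NM w by (simp add: smult_l_distr M.a_ac)
      then show "u \<oplus>\<^bsub>M\<^esub> v \<in> ?S" using u v submoduleE(5)[OF N] by blast
    }
    fix a assume a: "a \<in> carrier R"
    then have "a \<odot>\<^bsub>M\<^esub> u = (a \<odot>\<^bsub>M\<^esub> y) \<oplus>\<^bsub>M\<^esub> (a \<otimes> s) \<odot>\<^bsub>M\<^esub> w"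
      using u NM w by (simp add: smult_r_distr smult_assoc1)
    then show "a \<odot>\<^bsub>M\<^esub> u \<in> ?S" using u a submoduleE(4)[OF N] by blast
  qed
qed

text \<open>If ax is in \<open>P\<close> but \<open>x\<close> is not, maximality gives P + Rx = M.
  By commutativity \<open>a\<close> moves past the coefficient of \<open>x\<close>, so aM lies in
  \<open>P\<close>.\<close>

lemma maximal_imp_prime:
  assumes "maximal_submodule R M P"
  shows "prime_submodule R M P"
proof -
  have P: "submodule P R M" using assms by (simp add: maximal_submodule_def)
  have "a \<odot>\<^bsub>M\<^esub> z \<in> P"
    if a: "a \<in> carrier R" and x: "x \<in> carrier M" "a \<odot>\<^bsub>M\<^esub> x \<in> P" "x \<notin> P" and z: "z \<in> carrier M" for a x z
  proof -
    have "{y \<oplus>\<^bsub>M\<^esub> s \<odot>\<^bsub>M\<^esub> x | y s. y \<in> P \<and> s \<in> carrier R} = carrier M"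
      using assms submodule_sum_cyclic[OF P x(1)] x(3) unfolding maximal_submodule_def by blast
    then obtain y s where zy: "z = y \<oplus>\<^bsub>M\<^esub> s \<odot>\<^bsub>M\<^esub> x" "y \<in> P" "s \<in> carrier R" using z by blast
    then have "a \<odot>\<^bsub>M\<^esub> z = a \<odot>\<^bsub>M\<^esub> y \<oplus>\<^bsub>M\<^esub> s \<odot>\<^bsub>M\<^esub> (a \<odot>\<^bsub>M\<^esub> x)"
      using a x submoduleE(1)[OF P]
      by (simp add: smult_r_distr subset_iff flip: smult_assoc1) (simp add: R.m_comm)
    then show ?thesis using a zy x submoduleE(4,5)[OF P] by simp
  qed
  then show ?thesis using P unfolding prime_submodule_iff by blast
qed

text \<open>Semiprimeness applied to \<open>r\<close> and r^k x lowers the exponent from k + 2 to k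
  + 1. Since \<open>t\<close> is positive, this descent ends at rx.\<close>

lemma envelope_subset_semiprime:
  assumes P: "semiprime_submodule R M P" "N \<subseteq> P"
  shows "envelope R M N \<subseteq> P"
proof
  fix z assume "z \<in> envelope R M N"
  then obtain r x t where z: "z = r \<odot>\<^bsub>M\<^esub> x" and r: "r \<in> carrier R" and x: "x \<in> carrier M"
    and t: "t > 0" "r [^] (t::nat) \<odot>\<^bsub>M\<^esub> x \<in> N"
    unfolding envelope_def by blast
  have "r [^] Suc k \<odot>\<^bsub>M\<^esub> x \<in> P \<Longrightarrow> r \<odot>\<^bsub>M\<^esub> x \<in> P" for k :: nat
  proof (induction k)
    case (Suc k)
    have step: "r [^] Suc i \<odot>\<^bsub>M\<^esub> x = r \<odot>\<^bsub>M\<^esub> (r [^] i \<odot>\<^bsub>M\<^esub> x)" for i :: nat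
      using r x by (simp add: R.m_comm smult_assoc1)
    have "r \<odot>\<^bsub>M\<^esub> (r \<odot>\<^bsub>M\<^esub> (r [^] k \<odot>\<^bsub>M\<^esub> x)) \<in> P"
      using Suc.prems by (simp only: step)
    then have "r [^] Suc k \<odot>\<^bsub>M\<^esub> x \<in> P"
      unfolding step using P(1) r x unfolding semiprime_submodule_iff
      by (meson R.nat_pow_closed smult_closed)
    then show ?case by (rule Suc.IH)
  qed (use r in simp)
  from this[of "t - 1"] show "z \<in> P" using t P(2) z by auto
qed

end

section \<open>Cyclic modules with stationary powers\<close>

text \<open>These are the two features of R/I on which the comparison of radicals rests: one
  generator, the class of 1, and descending chains of the submodules generated by a^j e that make no
  strict step at some \<open>j\<close>.\<close>

locale cyclic_stationary_module = plain_module +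
  fixes e
  assumes gen_closed: "e \<in> carrier M"
    and generated: "x \<in> carrier M \<Longrightarrow> \<exists>r\<in>carrier R. x = r \<odot>\<^bsub>M\<^esub> e"
    and stationary: "a \<in> carrier R \<Longrightarrow>
      \<exists>(j::nat). \<exists>b\<in>carrier R. (a [^] j) \<odot>\<^bsub>M\<^esub> e = (a [^] Suc j \<otimes> b) \<odot>\<^bsub>M\<^esub> e"
begin

lemma submodule_eq_carrier:
  assumes "submodule N R M" "e \<in> N"
  shows "N = carrier M"
proof (intro equalityI subsetI)
  fix x assume "x \<in> carrier M"
  from generated[OF this] obtain r where "r \<in> carrier R" "x = r \<odot>\<^bsub>M\<^esub> e" by (elim bexE)
  then show "x \<in> N" using submoduleE(4)[OF assms(1) _ assms(2)] by simp
qed (use submoduleE(1)[OF assms(1)] in blast)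

text \<open>A submodule is proper exactly if it omits the generator \<open>e\<close>. This property
  survives unions of chains, so Zorn's lemma applies to the submodules that contain \<open>N\<close>
  and omit \<open>e\<close>.\<close>

lemma exists_maximal_submodule:
  assumes N: "submodule N R M" "e \<notin> N"
  obtains P where "maximal_submodule R M P" "N \<subseteq> P"
proof -
  define F where "F = {P. submodule P R M \<and> N \<subseteq> P \<and> e \<notin> P}"
  have "N \<in> F" using N by (simp add: F_def)
  then have "F \<noteq> {}" by blast
  moreover have "\<Union>C \<in> F" if C: "C \<noteq> {}" "subset.chain F C" for C
  proof -
    have CF: "\<And>P. P \<in> C \<Longrightarrow> submodule P R M \<and> N \<subseteq> P \<and> e \<notin> P"
      using C(2) by (auto simp: subset_chain_def F_def)
    have "submodule (\<Union>C) R M"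
    proof (rule submoduleI)
      show "\<zero>\<^bsub>M\<^esub> \<in> \<Union>C" using C(1) CF submodule_zero by blast
      fix u v assume "u \<in> \<Union>C" "v \<in> \<Union>C"
      \<comment> \<open>Of two members of the chain containing \<open>u\<close> and
        \<open>v\<close>, the larger contains both.\<close>
      then obtain P where "P \<in> C" "u \<in> P" "v \<in> P"
        using C(2) unfolding subset_chain_def by (metis UnionE subsetD)
      then show "u \<oplus>\<^bsub>M\<^esub> v \<in> \<Union>C" using CF submoduleE(5) by blast
    qed (use CF submoduleE(1,3,4) in \<open>blast+\<close>)
    then show ?thesis using C(1) CF unfolding F_def by blast
  qed
  ultimately obtain P where P: "P \<in> F" "\<And>Q. Q \<in> F \<Longrightarrow> P \<subseteq> Q \<Longrightarrow> Q = P"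
    using subset_Zorn_nonempty[of F] by blast
  \<comment> \<open>A submodule strictly above \<open>P\<close> is not in \<open>F\<close>, hence
    contains \<open>e\<close> and is all of \<open>M\<close>.\<close>
  have "maximal_submodule R M P"
    unfolding maximal_submodule_def
    using P submodule_eq_carrier gen_closed unfolding F_def by blast
  then show ?thesis using that P(1) by (auto simp: F_def)
qed

text \<open>
  If \<open>a\<^sup>j e = a\<^sup>j\<^sup>+\<^sup>1 b e\<close> and \<open>a e\<close> lies in all maximal submodules containing \<open>N\<close>, then \<open>e - a b e\<close>,
  which is killed by \<open>a\<^sup>j\<close>, lies in none of them; so it generates \<open>M\<close> modulo \<open>N\<close>, and
  \<open>a\<^sup>j e \<in> N\<close>.
\<close>

lemma Inter_maximal_subset_envelope:
  assumes N: "submodule N R M"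
    and x: "x \<in> carrier M" "\<And>P. maximal_submodule R M P \<Longrightarrow> N \<subseteq> P \<Longrightarrow> x \<in> P"
  shows "x \<in> envelope R M N"
proof -
  note e = gen_closed
  obtain a where a: "a \<in> carrier R" "x = a \<odot>\<^bsub>M\<^esub> e" using generated[OF x(1)] by blast
  obtain j :: nat and b where b: "b \<in> carrier R"
    and j: "(a [^] j) \<odot>\<^bsub>M\<^esub> e = (a [^] Suc j \<otimes> b) \<odot>\<^bsub>M\<^esub> e"
    using stationary[OF a(1)] by blast
  define w where "w = e \<ominus>\<^bsub>M\<^esub> (b \<otimes> a) \<odot>\<^bsub>M\<^esub> e"
  have w: "w \<in> carrier M" using a b e by (simp add: w_def)
  have "(a [^] j) \<odot>\<^bsub>M\<^esub> w = (a [^] j) \<odot>\<^bsub>M\<^esub> e \<ominus>\<^bsub>M\<^esub> (a [^] j) \<odot>\<^bsub>M\<^esub> ((b \<otimes> a) \<odot>\<^bsub>M\<^esub> e)"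
    using a b e by (simp add: w_def a_minus_def smult_r_distr smult_r_minus)
  also have "(a [^] j) \<odot>\<^bsub>M\<^esub> ((b \<otimes> a) \<odot>\<^bsub>M\<^esub> e) = (a [^] Suc j \<otimes> b) \<odot>\<^bsub>M\<^esub> e"
    using a b e by (simp add: R.m_ac flip: smult_assoc1)
  finally have jw: "(a [^] j) \<odot>\<^bsub>M\<^esub> w = \<zero>\<^bsub>M\<^esub>"
    using j a b e by (simp add: M.r_neg a_minus_def del: R.nat_pow_Suc)
  let ?S = "{y \<oplus>\<^bsub>M\<^esub> s \<odot>\<^bsub>M\<^esub> w | y s. y \<in> N \<and> s \<in> carrier R}"
  note S = submodule_sum_cyclic[OF N w]
  have "e \<in> ?S"
  proof (rule ccontr)
    assume "e \<notin> ?S"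
    then obtain P where P: "maximal_submodule R M P" "?S \<subseteq> P"
      using exists_maximal_submodule[OF S(1)] by blast
    have sP: "submodule P R M" using P(1) by (simp add: maximal_submodule_def)
    have "x \<in> P" using x(2)[OF P(1)] S(2) P(2) by blast
    then have "(b \<otimes> a) \<odot>\<^bsub>M\<^esub> e \<in> P" using submoduleE(4)[OF sP b] a b e by (simp add: smult_assoc1)
    moreover have "w \<in> P" using S(3) P(2) by blast
    moreover have "e = w \<oplus>\<^bsub>M\<^esub> (b \<otimes> a) \<odot>\<^bsub>M\<^esub> e"
      using a b e by (simp add: w_def a_minus_def M.a_assoc M.l_neg)
    ultimately have "e \<in> P" using submoduleE(5)[OF sP] by metis
    then show False using submodule_eq_carrier[OF sP] P(1) by (simp add: maximal_submodule_def)
  qed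
  then obtain y s where y: "e = y \<oplus>\<^bsub>M\<^esub> s \<odot>\<^bsub>M\<^esub> w" "y \<in> N" "s \<in> carrier R" by blast
  have yM: "y \<in> carrier M" using y(2) submoduleE(1)[OF N] by blast
  have "(a [^] j) \<odot>\<^bsub>M\<^esub> e = (a [^] j) \<odot>\<^bsub>M\<^esub> y \<oplus>\<^bsub>M\<^esub> (a [^] j) \<odot>\<^bsub>M\<^esub> (s \<odot>\<^bsub>M\<^esub> w)"
    by (subst y(1)) (use a y yM w in \<open>simp add: smult_r_distr\<close>)
  also have "(a [^] j) \<odot>\<^bsub>M\<^esub> (s \<odot>\<^bsub>M\<^esub> w) = s \<odot>\<^bsub>M\<^esub> ((a [^] j) \<odot>\<^bsub>M\<^esub> w)"
    using a y w by (simp add: R.m_comm flip: smult_assoc1)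
  finally have "(a [^] j) \<odot>\<^bsub>M\<^esub> e \<in> N"
    using jw y yM a submoduleE(4)[OF N] by simp
  \<comment> \<open>The envelope asks for a positive exponent, while \<open>j\<close> may be 0; one
    more factor \<open>a\<close> settles this.\<close>
  moreover have "(a [^] Suc j) \<odot>\<^bsub>M\<^esub> e = a \<odot>\<^bsub>M\<^esub> ((a [^] j) \<odot>\<^bsub>M\<^esub> e)"
    using a e by (simp add: R.m_comm smult_assoc1)
  ultimately have "(a [^] Suc j) \<odot>\<^bsub>M\<^esub> e \<in> N"
    using submoduleE(4)[OF N a(1)] by metis
  then show ?thesis unfolding envelope_def using a e by blast
qed

text \<open>The inclusions close up to a cycle. Keeping \<open>N\<close> arbitrary serves both
  claims: the prime case is the radical formula for \<open>N\<close>, and all three cases at the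
  zero submodule give the equality of the radicals.\<close>

lemma radicals_eq_generated_envelope:
  assumes N: "submodule N R M"
  shows "submodule_generated R M (envelope R M N) = Inter_in M {P. semiprime_submodule R M P \<and> N \<subseteq> P}"
    and "submodule_generated R M (envelope R M N) = Inter_in M {P. prime_submodule R M P \<and> N \<subseteq> P}"
    and "submodule_generated R M (envelope R M N) = Inter_in M {P. maximal_submodule R M P \<and> N \<subseteq> P}"
proof -
  let ?E = "submodule_generated R M (envelope R M N)"
  let ?S = "Inter_in M {P. semiprime_submodule R M P \<and> N \<subseteq> P}"
  let ?B = "Inter_in M {P. prime_submodule R M P \<and> N \<subseteq> P}"
  let ?J = "Inter_in M {P. maximal_submodule R M P \<and> N \<subseteq> P}"
  have "?E \<subseteq> ?S"
  proof -
    have "submodule P R M \<and> envelope R M N \<subseteq> P" if "semiprime_submodule R M P" "N \<subseteq> P" for P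
      using envelope_subset_semiprime that semiprime_submodule_def by blast
    then show ?thesis unfolding submodule_generated_def Inter_in_def by blast
  qed
  moreover have "?S \<subseteq> ?B" using prime_imp_semiprime unfolding Inter_in_def by blast
  moreover have "?B \<subseteq> ?J" using maximal_imp_prime unfolding Inter_in_def by blast
  moreover have "?J \<subseteq> ?E"
    using Inter_maximal_subset_envelope[OF N] unfolding submodule_generated_def Inter_in_def by blast
  ultimately show "?E = ?S" "?E = ?B" "?E = ?J" by auto
qed

theorem radicals_coincide:
  "submodule_generated R M (envelope R M {\<zero>\<^bsub>M\<^esub>}) = semiprime_radical R M
    \<and> semiprime_radical R M = prime_radical R M
    \<and> prime_radical R M = jacobson_radical R M
    \<and> radical_formula R M"
proof -
  have "submodule {\<zero>\<^bsub>M\<^esub>} R M" by (rule submoduleI) auto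
  note zero = radicals_eq_generated_envelope[OF this]
  \<comment> \<open>Every submodule contains zero, so at the zero submodule the relative radicals
    are the absolute ones.\<close>
  have "{P. semiprime_submodule R M P \<and> {\<zero>\<^bsub>M\<^esub>} \<subseteq> P} = {P. semiprime_submodule R M P}"
    "{P. prime_submodule R M P \<and> {\<zero>\<^bsub>M\<^esub>} \<subseteq> P} = {P. prime_submodule R M P}"
    "{P. maximal_submodule R M P \<and> {\<zero>\<^bsub>M\<^esub>} \<subseteq> P} = {P. maximal_submodule R M P}"
    using submodule_zero
    by (auto simp: semiprime_submodule_def prime_submodule_def maximal_submodule_def)
  with zero show ?thesis
    using radicals_eq_generated_envelope(2)
    by (simp add: semiprime_radical_def prime_radical_def jacobson_radical_def radical_formula_def
        submodule_radical_formula_def prime_radical_of_def)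
qed

end

section \<open>Powers in finite-dimensional algebras\<close>

text \<open>The multiples of \<open>c\<close> form an ideal and so absorb linear combinations over
  \<open>K\<close>. With c = a^(j+1) this controls the span of all higher powers of
  \<open>a\<close>.\<close>

lemma (in cring) Span_subset_multiples:
  assumes K: "subfield K R" and c: "c \<in> carrier R"
    and "\<And>u. u \<in> set Us \<Longrightarrow> \<exists>b\<in>carrier R. u = c \<otimes> b"
    and "v \<in> Span K Us"
  shows "\<exists>b\<in>carrier R. v = c \<otimes> b"
  using assms(3,4)
proof (induction Us arbitrary: v)
  case Nil
  then show ?case using c by (auto intro!: bexI[of _ \<zero>])
next
  case (Cons u Us)
  from Cons.prems(2) obtain k w where k: "k \<in> K" and w: "w \<in> Span K Us" and v: "v = k \<otimes> u \<oplus> w"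
    by (auto simp: line_extension_mem_iff)
  from Cons.prems(1)[of u] obtain b1 where "b1 \<in> carrier R" "u = c \<otimes> b1"
    unfolding list.set by blast
  moreover have "\<exists>b\<in>carrier R. w = c \<otimes> b"
    by (rule Cons.IH[OF Cons.prems(1) w]) simp
  then obtain b2 where "b2 \<in> carrier R" "w = c \<otimes> b2" by blast
  moreover have "k \<in> carrier R" using k subfieldE(3)[OF K] by blast
  ultimately show ?case
    using c v by (intro bexI[of _ "k \<otimes> b1 \<oplus> b2"]) (simp_all add: r_distr m_lcomm)
qed

text \<open>
  If \<open>a\<^sup>j\<close> is never a multiple of \<open>a\<^sup>j\<^sup>+\<^sup>1\<close>, it is never in the span of finitely many higher powers,
  so all powers of \<open>a\<close> are linearly independent.
\<close>

lemma (in cring) finite_dimension_power_stationary: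
  assumes K: "subfield K R" and fin: "finite_dimension K (carrier R)" and a: "a \<in> carrier R"
  shows "\<exists>(j::nat). \<exists>b\<in>carrier R. a [^] j = a [^] Suc j \<otimes> b"
proof (rule ccontr)
  assume neg: "\<not> ?thesis"
  \<comment> \<open>The start \<open>j\<close> varies in the induction because splitting off the
    lowest power leaves a list that starts at \<open>Suc j\<close>.\<close>
  have ind: "independent K (map (\<lambda>i. a [^] i) [j..<j + m])" for j m :: nat
  proof (induction m arbitrary: j)
    case (Suc m)
    let ?Us = "map (\<lambda>i. a [^] i) [Suc j..<Suc j + m]"
    have "\<exists>b\<in>carrier R. u = a [^] Suc j \<otimes> b" if "u \<in> set ?Us" for u
    proof -
      from that obtain i where "Suc j \<le> i" "u = a [^] i"
        unfolding set_map set_upt by auto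
      then have "u = a [^] Suc j \<otimes> a [^] (i - Suc j)"
        by (simp only: nat_pow_mult[OF a] le_add_diff_inverse)
      then show ?thesis using a by blast
    qed
    then have "a [^] j \<notin> Span K ?Us"
      using Span_subset_multiples[OF K, of "a [^] Suc j" ?Us "a [^] j"] neg a by auto
    then have "independent K (a [^] j # ?Us)"
      using li_Cons[OF _ _ Suc.IH] a by blast
    moreover have "[j..<j + Suc m] = j # [Suc j..<Suc j + m]"
      by (simp add: upt_conv_Cons del: upt_Suc)
    ultimately show ?case by (simp only: list.map)
  qed simp
  obtain d where d: "dimension d K (carrier R)" using fin by blast
  \<comment> \<open>In dimension \<open>d\<close>, the d + 1 powers from a^0 to a^d cannot be
    independent.\<close>
  have "length (map (\<lambda>i. a [^] i) [0..<0 + Suc d]) \<le> d"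
    by (rule independent_length_le_dimension[OF K d ind]) (use a in auto)
  then show False by simp
qed

section \<open>The polynomial ring\<close>

lemma mpoly_ring_simps [simp]:
  "carrier (mpoly_ring n) = {p. Poly_Mapping.keys p \<subseteq> exponents n}"
  "p \<otimes>\<^bsub>mpoly_ring n\<^esub> q = p * q" "p \<oplus>\<^bsub>mpoly_ring n\<^esub> q = p + q"
  "\<one>\<^bsub>mpoly_ring n\<^esub> = 1" "\<zero>\<^bsub>mpoly_ring n\<^esub> = 0"
  by (simp_all add: mpoly_ring_def)

lemma zero_in_exponents [simp]: "0 \<in> exponents n"
  by (simp add: exponents_def)

lemma exponents_add: "d \<in> exponents n \<Longrightarrow> e \<in> exponents n \<Longrightarrow> d + e \<in> exponents n"
  unfolding exponents_def using Poly_Mapping.keys_add[of d e] by blast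

lemma mpoly_ring_cring: "cring (mpoly_ring n :: 'k::field mpol ring)"
proof (rule cringI)
  show "abelian_group (mpoly_ring n :: 'k mpol ring)"
  proof (rule abelian_groupI)
    fix p :: "'k mpol"
    assume "p \<in> carrier (mpoly_ring n)"
    then show "\<exists>q\<in>carrier (mpoly_ring n). q \<oplus>\<^bsub>mpoly_ring n\<^esub> p = \<zero>\<^bsub>mpoly_ring n\<^esub>"
      by (intro bexI[of _ "- p"]) (auto simp: in_keys_iff subset_iff)
  next
    fix p q :: "'k mpol"
    assume "p \<in> carrier (mpoly_ring n)" "q \<in> carrier (mpoly_ring n)"
    then show "p \<oplus>\<^bsub>mpoly_ring n\<^esub> q \<in> carrier (mpoly_ring n)"
      using Poly_Mapping.keys_add[of p q] by auto
  qed (simp_all add: add_ac)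
  show "comm_monoid (mpoly_ring n :: 'k mpol ring)"
  proof (rule comm_monoidI)
    fix p q :: "'k mpol"
    assume "p \<in> carrier (mpoly_ring n)" "q \<in> carrier (mpoly_ring n)"
    \<comment> \<open>An exponent occurring in a product is a sum of exponents of the factors, so no
      new variable appears.\<close>
    then show "p \<otimes>\<^bsub>mpoly_ring n\<^esub> q \<in> carrier (mpoly_ring n)"
      using keys_mult[of p q] exponents_add by fastforce
  qed (simp_all add: mult_ac)
qed (simp add: distrib_right)

lemma monomials_subset_carrier: "monomials n \<subseteq> carrier (mpoly_ring n)"
  by (auto simp: monomials_def)

text \<open>The map \<open>const_poly\<close> respects sums and products, and the constant
  \<open>inverse c\<close> inverts the constant \<open>c\<close>. The copy of k thus obtained can
  act as the scalars in the notion of dimension.\<close>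

lemma range_const_poly_subfield:
  "subfield (range const_poly) (mpoly_ring n :: 'k::field mpol ring)"
proof -
  interpret cring "mpoly_ring n :: 'k mpol ring" by (rule mpoly_ring_cring)
  have mem: "const_poly c \<in> carrier (mpoly_ring n)" for c :: 'k
    by (simp add: const_poly_def)
  have one: "const_poly 1 = (1 :: 'k mpol)" and zero: "const_poly 0 = (0 :: 'k mpol)"
    and mult: "const_poly (c * d) = const_poly c * const_poly d"
    and plus: "const_poly (c + d) = const_poly c + const_poly d" for c d :: 'k
    by (simp_all add: const_poly_def mult_single single_add)
  have minus: "\<ominus>\<^bsub>mpoly_ring n\<^esub> const_poly c = const_poly (- c)" for c :: 'k
    by (rule minus_equality) (use mem in \<open>simp_all add: zero flip: plus\<close>)
  have sub: "subring (range const_poly) (mpoly_ring n :: 'k mpol ring)"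
  proof (rule subringI)
    show "\<one>\<^bsub>mpoly_ring n\<^esub> \<in> range (const_poly :: 'k \<Rightarrow> 'k mpol)"
      unfolding mpoly_ring_simps by (rule range_eqI) (rule one[symmetric])
  qed (use mem in \<open>auto simp: minus simp flip: mult plus\<close>)
  show ?thesis
  proof (rule subfieldI[OF subcringI'[OF sub]])
    let ?K = "mpoly_ring n\<lparr>carrier := range const_poly\<rparr> :: 'k mpol ring"
    show "Units ?K = range const_poly - {\<zero>\<^bsub>mpoly_ring n :: 'k mpol ring\<^esub>}"
    proof (intro equalityI subsetI)
      fix p :: "'k mpol" assume "p \<in> Units ?K"
      then show "p \<in> range const_poly - {\<zero>\<^bsub>mpoly_ring n\<^esub>}" by (auto simp: Units_def)
    next
      fix p :: "'k mpol"
      assume "p \<in> range const_poly - {\<zero>\<^bsub>mpoly_ring n\<^esub>}"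
      then obtain c where c: "p = const_poly c" "c \<noteq> 0" using zero by auto
      then have "const_poly (inverse c) * p = 1" "p * const_poly (inverse c) = 1"
        by (simp_all add: one flip: mult)
      then show "p \<in> Units ?K" using c(1) by (auto simp: Units_def)
    qed
  qed
qed

section \<open>Finite-dimensional quotients of polynomial rings\<close>

lemma regular_module_simps [simp]:
  "carrier (regular_module R) = carrier R" "\<zero>\<^bsub>regular_module R\<^esub> = \<zero>\<^bsub>R\<^esub>"
  "add (regular_module R) = add R" "smult (regular_module R) = monoid.mult R"
  by (simp_all add: regular_module_def ring.defs module.defs)

lemma regular_module_coset [simp]: "I +>\<^bsub>regular_module R\<^esub> x = I +>\<^bsub>R\<^esub> x"
  by (simp add: a_r_coset_def')

lemma regular_plain_module:
  fixes R :: "'a ring"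
  assumes "cring R"
  shows "plain_module R (regular_module R)"
proof -
  interpret cring R by (rule assms)
  have "abelian_group (regular_module R)"
    by (rule abelian_groupI) (auto simp: a_ac intro: add.l_inv_ex)
  then have "module R (regular_module R)"
    by (intro moduleI assms) (auto simp: l_distr r_distr m_assoc)
  then show ?thesis by (simp add: plain_module_def)
qed

lemma ideal_submodule_regular_module:
  fixes R :: "'a ring"
  assumes "cring R" "ideal I R"
  shows "submodule I R (regular_module R)"
proof -
  interpret ideal I R by (rule assms(2))
  interpret M: plain_module R "regular_module R" by (rule regular_plain_module[OF assms(1)])
  have "\<ominus>\<^bsub>regular_module R\<^esub> x = \<ominus>\<^bsub>R\<^esub> x" for x
    by (simp add: a_inv_def m_inv_def)
  then show ?thesis
    by (intro M.submoduleI) (use a_subset in \<open>auto intro: I_l_closed\<close>)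
qed

text \<open>Acting with \<open>r\<close> on the class of 1 gives the class of \<open>r\<close>. So
  this class generates the module, and an equation between powers in the ring R/I becomes one
  between actions on the generator.\<close>

lemma quotient_cyclic_stationary_module:
  fixes R :: "'a ring"
  assumes "cring R" and I: "ideal I R"
    and stat: "\<And>A. A \<in> carrier (R Quot I) \<Longrightarrow>
      \<exists>(j::nat). \<exists>B\<in>carrier (R Quot I). A [^]\<^bsub>R Quot I\<^esub> j = A [^]\<^bsub>R Quot I\<^esub> Suc j \<otimes>\<^bsub>R Quot I\<^esub> B"
  shows "cyclic_stationary_module R (quotient_module (regular_module R) I) (I +>\<^bsub>R\<^esub> \<one>\<^bsub>R\<^esub>)"
proof -
  interpret cring R by (rule assms(1))
  interpret RM: plain_module R "regular_module R" by (rule regular_plain_module[OF assms(1)])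
  note sub = ideal_submodule_regular_module[OF assms(1) I]
  interpret M: plain_module R "quotient_module (regular_module R) I"
    by (rule RM.quotient_plain_module[OF sub])
  interpret h: ring_hom_ring R "R Quot I" "(+>\<^bsub>R\<^esub>) I" by (rule ideal.rcos_ring_hom_ring[OF I])
  have smult: "r \<odot>\<^bsub>quotient_module (regular_module R) I\<^esub> (I +>\<^bsub>R\<^esub> \<one>\<^bsub>R\<^esub>) = I +>\<^bsub>R\<^esub> r"
    if "r \<in> carrier R" for r
    using RM.quotient_smult_coset[OF sub, of r "\<one>\<^bsub>R\<^esub>"] that
    by (simp del: quotient_module_simps h.hom_one)
  have carr: "carrier (quotient_module (regular_module R) I) = (\<lambda>x. I +>\<^bsub>R\<^esub> x) ` carrier R"
    by (auto simp: A_RCOSETS_def')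
  have carrQ: "carrier (R Quot I) = (\<lambda>x. I +>\<^bsub>R\<^esub> x) ` carrier R"
    unfolding FactRing_def A_RCOSETS_def' partial_object.simps by blast
  show ?thesis
  proof (unfold_locales, goal_cases)
    case 1
    then show ?case unfolding carr by (rule imageI) simp
  next
    case (2 x)
    then show ?case unfolding carr using smult by fastforce
  next
    case (3 a)
    then have "I +>\<^bsub>R\<^esub> a \<in> carrier (R Quot I)" by simp
    from stat[OF this] obtain j :: nat and b where b: "b \<in> carrier R"
      and eq: "(I +>\<^bsub>R\<^esub> a) [^]\<^bsub>R Quot I\<^esub> j = (I +>\<^bsub>R\<^esub> a) [^]\<^bsub>R Quot I\<^esub> Suc j \<otimes>\<^bsub>R Quot I\<^esub> (I +>\<^bsub>R\<^esub> b)"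
      unfolding carrQ by blast
    have pow: "I +>\<^bsub>R\<^esub> (a [^]\<^bsub>R\<^esub> k) = (I +>\<^bsub>R\<^esub> a) [^]\<^bsub>R Quot I\<^esub> k" for k :: nat
      using 3 by (induction k) simp_all
    have "I +>\<^bsub>R\<^esub> (a [^]\<^bsub>R\<^esub> j) = I +>\<^bsub>R\<^esub> (a [^]\<^bsub>R\<^esub> Suc j \<otimes>\<^bsub>R\<^esub> b)"
      using eq b 3 by (simp add: pow)
    then have "(a [^]\<^bsub>R\<^esub> j) \<odot>\<^bsub>quotient_module (regular_module R) I\<^esub> (I +>\<^bsub>R\<^esub> \<one>\<^bsub>R\<^esub>) =
        (a [^]\<^bsub>R\<^esub> Suc j \<otimes>\<^bsub>R\<^esub> b) \<odot>\<^bsub>quotient_module (regular_module R) I\<^esub> (I +>\<^bsub>R\<^esub> \<one>\<^bsub>R\<^esub>)"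
      using smult[of "a [^]\<^bsub>R\<^esub> j"] smult[of "a [^]\<^bsub>R\<^esub> Suc j \<otimes>\<^bsub>R\<^esub> b"] b 3
      by (metis m_closed nat_pow_closed)
    then show ?case using b by blast
  qed
qed

lemma finite_dim_quotient_power_stationary:
  fixes n :: nat and I :: "'k::field mpol set"
  defines "Q \<equiv> mpoly_ring n Quot I"
  assumes I: "ideal I (mpoly_ring n)" and fin: "finite_dim_quotient n I" and A: "A \<in> carrier Q"
  shows "\<exists>(j::nat). \<exists>B\<in>carrier Q. A [^]\<^bsub>Q\<^esub> j = A [^]\<^bsub>Q\<^esub> Suc j \<otimes>\<^bsub>Q\<^esub> B"
proof -
  interpret Q: cring Q
    unfolding Q_def by (rule ideal.quotient_is_cring[OF I mpoly_ring_cring])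
  interpret h: ring_hom_ring "mpoly_ring n" Q "(+>\<^bsub>mpoly_ring n\<^esub>) I"
    unfolding Q_def by (rule ideal.rcos_ring_hom_ring[OF I])
  show ?thesis
  proof (cases "\<one>\<^bsub>Q\<^esub> = \<zero>\<^bsub>Q\<^esub>")
    \<comment> \<open>In the zero ring the image of k is {0}, which is not a subfield, so the
      dimension argument cannot be used; but any two elements are equal, and j = 0 with B = A will
      do.\<close>
    case True
    then have "carrier Q = {\<zero>\<^bsub>Q\<^esub>}" using Q.one_zeroD by blast
    moreover have "A [^]\<^bsub>Q\<^esub> (0::nat) \<in> carrier Q" "A [^]\<^bsub>Q\<^esub> Suc 0 \<otimes>\<^bsub>Q\<^esub> A \<in> carrier Q"
      using A by simp_all
    ultimately have "A [^]\<^bsub>Q\<^esub> (0::nat) = A [^]\<^bsub>Q\<^esub> Suc 0 \<otimes>\<^bsub>Q\<^esub> A" by auto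
    then show ?thesis using A by blast
  next
    case False
    \<comment> \<open>A ring homomorphism into a nonzero ring maps a subfield onto a
      subfield.\<close>
    have "subfield ((+>\<^bsub>mpoly_ring n\<^esub>) I ` range const_poly) Q"
      using h.img_is_subfield(2)[OF range_const_poly_subfield False] .
    moreover have "Q.finite_dimension ((+>\<^bsub>mpoly_ring n\<^esub>) I ` range const_poly) (carrier Q)"
      using fin unfolding finite_dim_quotient_def Q_def by (simp add: image_image)
    ultimately show ?thesis using Q.finite_dimension_power_stationary A by blast
  qed
qed

theorem theorem5p1:
  fixes n :: nat
    and I :: "'k::field mpol set"
  defines "R \<equiv> (mpoly_ring n :: 'k mpol ring)"
  defines "M \<equiv> quotient_module (regular_module R) I"
  assumes "monomial_ideal n I"
    and "finite_dim_quotient n I"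
  shows "submodule_generated R M (envelope R M {\<zero>\<^bsub>M\<^esub>}) = semiprime_radical R M
       \<and> semiprime_radical R M = prime_radical R M
       \<and> prime_radical R M = jacobson_radical R M
       \<and> radical_formula R M"
proof -
  interpret cring R unfolding R_def by (rule mpoly_ring_cring)
  have I: "ideal I R"
    using assms(3) genideal_ideal monomials_subset_carrier
    unfolding monomial_ideal_def R_def by blast
  have "cyclic_stationary_module R M (I +>\<^bsub>R\<^esub> \<one>\<^bsub>R\<^esub>)"
    unfolding M_def
    by (rule quotient_cyclic_stationary_module[OF is_cring I])
      (unfold R_def, rule finite_dim_quotient_power_stationary[OF I[unfolded R_def] assms(4)])
  then show ?thesis by (rule cyclic_stationary_module.radicals_coincide)
qed

end
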